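(* Let the graphs $M(t)$, $t\ge 0$, be defined as in the context. Then for every integer $t\ge 1$, the number $s(t)$ of spanning trees of $M(t)$ equals $$s(t)=\prod_{i=1}^{t}\left[\,2-\sqrt{2}+\frac{2\sqrt{2}}{1-(3-2\sqrt{2})^{i}}\,\right]^{2^{t-i}}.$$
   Context: The graphs $M(t)$ are finite simple graphs, each equipped with a distinguished edge $\{u_t,v_t\}$, defined recursively. $M(0)$ consists of two vertices $u_0,v_0$ joined by one edge, which is its distinguished edge. For $t\ge 1$, $M(t)$ is obtained by taking two vertex-disjoint copies of $M(t-1)$, with distinguished edges $\{u',v'\}$ in the first copy and $\{u'',v''\}$ in the second copy (where $u',u''$ are the copies of $u_{t-1}$ and $v',v''$ the copies of $v_{t-1}$), and adding the two new edges $\{u',u''\}$ and $\{v',v''\}$; the distinguished edge of $M(t)$ is $\{u_t,v_t\}=\{u',u''\}$. (Thus $M(1)$ is the $4$-cycle, and $M(t)$ has $2^{t+1}$ vertices and $3\cdot 2^{t}-2$ edges; at each step the two new edges join the two adjacent vertices of maximum degree that were used as connecting vertices at the previous step in each copy.) A spanning tree of a graph is a subgraph containing all its vertices that is a tree. *)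

theory Defs
  imports Complex_Main
begin

(* HOL-Library and the AFP entry Graph_Theory have no undirected trees: the trees of Graph_Theory
   exclude directed cycles, so the two opposite arcs that represent an undirected edge would
   already count as a cycle.  The vocabulary is therefore set up here for graphs whose edges are
   two-element sets of vertices. *)

record 'a sgraph =
  vertices :: "'a set"
  edges :: "'a set set"

definition simple_graph :: "'a sgraph \<Rightarrow> bool" where
  "simple_graph G \<longleftrightarrow> (\<forall>e\<in>edges G. e \<subseteq> vertices G \<and> card e = 2)"

definition finite_simple_graph :: "'a sgraph \<Rightarrow> bool" where
  "finite_simple_graph G \<longleftrightarrow> simple_graph G \<and> finite (vertices G)"

definition sub_graph :: "'a sgraph \<Rightarrow> 'a sgraph \<Rightarrow> bool" where
  "sub_graph H G \<longleftrightarrow> simple_graph H \<and> vertices H \<subseteq> vertices G \<and> edges H \<subseteq> edges G"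

definition is_walk :: "'a sgraph \<Rightarrow> 'a list \<Rightarrow> bool" where
  "is_walk G p \<longleftrightarrow> p \<noteq> [] \<and> set p \<subseteq> vertices G \<and>
     (\<forall>i. Suc i < length p \<longrightarrow> {p ! i, p ! Suc i} \<in> edges G)"

definition connected_graph :: "'a sgraph \<Rightarrow> bool" where
  "connected_graph G \<longleftrightarrow> vertices G \<noteq> {} \<and>
     (\<forall>x\<in>vertices G. \<forall>y\<in>vertices G. \<exists>p. is_walk G p \<and> hd p = x \<and> last p = y)"

(* A cycle is listed without repeating its first vertex; it has at least three vertices. *)
definition is_cycle :: "'a sgraph \<Rightarrow> 'a list \<Rightarrow> bool" where
  "is_cycle G p \<longleftrightarrow> is_walk G p \<and> distinct p \<and> length p \<ge> 3 \<and> {last p, hd p} \<in> edges G"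

definition is_tree :: "'a sgraph \<Rightarrow> bool" where
  "is_tree G \<longleftrightarrow> simple_graph G \<and> connected_graph G \<and> (\<nexists>p. is_cycle G p)"

definition is_spanning_tree :: "'a sgraph \<Rightarrow> 'a sgraph \<Rightarrow> bool" where
  "is_spanning_tree H G \<longleftrightarrow> sub_graph H G \<and> vertices H = vertices G \<and> is_tree H"

definition num_spanning_trees :: "'a sgraph \<Rightarrow> nat" where
  "num_spanning_trees G = card {H. is_spanning_tree H G}"

(* Vertices are Boolean lists: prefixing False or True to a vertex gives its copy in the first or
   second of the two disjoint copies.  The pair (u_t, v_t) is (M_u t, M_v t). *)

primrec M_u :: "nat \<Rightarrow> bool list" where
  "M_u 0 = [False]"
| "M_u (Suc t) = False # M_u t"

primrec M_v :: "nat \<Rightarrow> bool list" where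
  "M_v 0 = [True]"
| "M_v (Suc t) = True # M_u t"

primrec M_graph :: "nat \<Rightarrow> bool list sgraph" where
  "M_graph 0 = \<lparr>vertices = {M_u 0, M_v 0}, edges = {{M_u 0, M_v 0}}\<rparr>"
| "M_graph (Suc t) =
     \<lparr>vertices = Cons False ` vertices (M_graph t) \<union> Cons True ` vertices (M_graph t),
      edges = image (Cons False) ` edges (M_graph t) \<union> image (Cons True) ` edges (M_graph t)
        \<union> {{False # M_u t, True # M_u t}, {False # M_v t, True # M_v t}}\<rparr>"

lemma M_distinguished_edge: "{M_u t, M_v t} \<in> edges (M_graph t)"
  by (cases t) auto

lemma finite_simple_graph_M: "finite_simple_graph (M_graph t)"
proof (induction t)
  case 0
  show ?case by (simp add: finite_simple_graph_def simple_graph_def)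
next
  case (Suc t)
  have sub: "e \<subseteq> vertices (M_graph t)" and two: "card e = 2" if "e \<in> edges (M_graph t)" for e
    using Suc that by (auto simp: finite_simple_graph_def simple_graph_def)
  have uv: "M_u t \<in> vertices (M_graph t)" "M_v t \<in> vertices (M_graph t)"
    using sub[OF M_distinguished_edge] by auto
  have card: "card (Cons b ` e) = 2" if "e \<in> edges (M_graph t)" for b and e
    using two[OF that] by (simp add: card_image)
  have copy: "Cons b ` e \<subseteq> Cons False ` vertices (M_graph t) \<union> Cons True ` vertices (M_graph t)"
    if "e \<in> edges (M_graph t)" for b and e
    using sub[OF that] by (cases b) auto
  have "finite (vertices (M_graph t))"
    using Suc by (simp add: finite_simple_graph_def)
  then show ?case
    using uv card copy unfolding finite_simple_graph_def simple_graph_def M_graph.simps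
    by (simp add: ball_Un)
qed

lemma card_vertices_M: "card (vertices (M_graph t)) = 2 ^ (t + 1)"
proof (induction t)
  case (Suc t)
  have "finite (vertices (M_graph t))"
    using finite_simple_graph_M by (auto simp: finite_simple_graph_def)
  moreover have "Cons False ` vertices (M_graph t) \<inter> Cons True ` vertices (M_graph t) = {}"
    by auto
  ultimately show ?case
    using Suc by (simp add: card_Un_disjoint card_image)
qed simp

lemma card_edges_M: "card (edges (M_graph t)) = 3 * 2 ^ t - 2"
proof (induction t)
  case (Suc t)
  let ?E = "edges (M_graph t)"
  let ?A = "image (Cons False) ` ?E" and ?B = "image (Cons True) ` ?E"
  let ?C = "{{False # M_u t, True # M_u t}, {False # M_v t, True # M_v t}}"
  have "?E \<subseteq> Pow (vertices (M_graph t))" "finite (vertices (M_graph t))"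
    using finite_simple_graph_M[of t] by (auto simp: finite_simple_graph_def simple_graph_def)
  then have fin: "finite ?E" by (meson finite_Pow_iff finite_subset)
  have ne: "{} \<notin> ?E"
    using finite_simple_graph_M[of t] by (auto simp: finite_simple_graph_def simple_graph_def)
  have uv: "M_u t \<noteq> M_v t" by (cases t) auto
  have inj: "inj_on (image (Cons b)) ?E" for b
    by (meson inj_image_eq_iff inj_onI inj_def list.inject)
  have AB: "?A \<inter> ?B = {}"
  proof -
    have "Cons False ` e \<noteq> Cons True ` f" if e: "e \<in> ?E" for e f
    proof -
      obtain x where "x \<in> e" using ne e by (metis all_not_in_conv)
      then show ?thesis by blast
    qed
    then show ?thesis by blast
  qed
  have C: "(?A \<union> ?B) \<inter> ?C = {}" by blast
  have "card ?C = 2" using uv by (simp add: doubleton_eq_iff)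
  then have "card (?A \<union> ?B \<union> ?C) = card ?E + card ?E + 2"
    using fin AB C inj by (subst card_Un_disjoint) (auto simp: card_Un_disjoint card_image)
  moreover have "(2::nat) ^ t \<ge> 1" by simp
  ultimately show ?case
    unfolding M_graph.simps sgraph.simps power_Suc Suc by linarith
qed simp

end

theory Submission
  imports Defs
begin

text \<open>
  Spanning trees are the edge sets that are minimal among those connecting all vertices, and an
  edge set connects the vertices iff every 2-colouring that is constant on each edge is constant.
  Let \<open>a\<close> be the number of spanning trees of \<open>M(t)\<close> and \<open>b\<close> the number of those containing the
  distinguished edge; deleting that edge, \<open>b\<close> also counts the spanning forests with two components
  that separate its ends. A spanning tree of \<open>M(t+1)\<close> that uses one new edge consists of a
  spanning tree in each copy; one that uses both consists of a spanning tree in one copy and a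
  separating forest in the other. Hence \<open>a' = 2a\<^sup>2 + 2ab\<close> and \<open>b' = a\<^sup>2 + 2ab\<close>, and the ratio
  \<open>r = b/a\<close> satisfies \<open>r' = (1 + 2r) / (2 + 2r)\<close>. This Moebius map has the fixed points
  \<open>\<plusminus>\<surd>2/2\<close>, which yields the closed form.
\<close>

section \<open>Trees as minimal connecting edge sets\<close>

definition monochrome :: "('a \<Rightarrow> bool) \<Rightarrow> 'a set set \<Rightarrow> bool" where
  "monochrome c F \<longleftrightarrow> (\<forall>e\<in>F. \<forall>x\<in>e. \<forall>y\<in>e. c x = c y)"

text \<open>A non-constant colouring amounts to a cut of \<open>V\<close> that no edge of
  \<open>F\<close> crosses. Unlike walks, colourings restrict to the two copies of a graph and can
  be assembled from them.\<close>

definition linked :: "'a set \<Rightarrow> 'a set set \<Rightarrow> bool" where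
  "linked V F \<longleftrightarrow> (\<forall>c. monochrome c F \<longrightarrow> (\<forall>x\<in>V. \<forall>y\<in>V. c x = c y))"

definition min_linked :: "'a set \<Rightarrow> 'a set set \<Rightarrow> bool" where
  "min_linked V F \<longleftrightarrow> linked V F \<and> (\<forall>e\<in>F. \<not> linked V (F - {e}))"

lemma monochrome_mono: "monochrome c F \<Longrightarrow> F' \<subseteq> F \<Longrightarrow> monochrome c F'"
  by (auto simp: monochrome_def)

lemma monochrome_edge: "monochrome c (insert {x, y} F) \<longleftrightarrow> c x = c y \<and> monochrome c F"
  by (auto simp: monochrome_def)

lemma monochrome_const: "monochrome (\<lambda>x. b) F"
  by (simp add: monochrome_def)

lemma monochrome_neg: "monochrome (\<lambda>x. \<not> c x) F \<longleftrightarrow> monochrome c F"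
  by (auto simp: monochrome_def)

lemma linked_mono: "linked V F \<Longrightarrow> F \<subseteq> F' \<Longrightarrow> linked V F'"
  unfolding linked_def using monochrome_mono by blast

section \<open>Walks and cycles in terms of colourings\<close>

lemma walk_monochrome:
  assumes "monochrome c (edges G)" and "is_walk G p"
  shows "c (hd p) = c (last p)"
proof -
  have "i < length p \<Longrightarrow> c (p ! i) = c (hd p)" for i
  proof (induction i)
    case 0
    then show ?case by (simp add: hd_conv_nth)
  next
    case (Suc i)
    then have "{p ! i, p ! Suc i} \<in> edges G" using assms(2) by (simp add: is_walk_def)
    then have "c (p ! i) = c (p ! Suc i)" using assms(1) by (simp add: monochrome_def)
    then show ?case using Suc by simp
  qed
  moreover have "p \<noteq> []" using assms(2) by (simp add: is_walk_def)
  ultimately show ?thesis by (simp add: last_conv_nth)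
qed

lemma is_walk_snoc:
  assumes "is_walk G p" and "{last p, y} \<in> edges G" and "y \<in> vertices G"
  shows "is_walk G (p @ [y])"
  unfolding is_walk_def
proof (intro conjI allI impI)
  fix i assume i: "Suc i < length (p @ [y])"
  show "{(p @ [y]) ! i, (p @ [y]) ! Suc i} \<in> edges G"
  proof (cases "Suc i < length p")
    case True
    then show ?thesis using assms(1) by (simp add: is_walk_def nth_append)
  next
    case False
    then have "Suc i = length p" using i by simp
    then have "p ! i = last p" by (metis diff_Suc_1 last_conv_nth list.size(3) nat.distinct(1))
    then show ?thesis using assms(2) \<open>Suc i = length p\<close> by (simp add: nth_append)
  qed
qed (use assms in \<open>auto simp: is_walk_def\<close>)

lemma is_walk_take: "is_walk G p \<Longrightarrow> 0 < n \<Longrightarrow> is_walk G (take n p)"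
  by (auto simp: is_walk_def dest: in_set_takeD)

text \<open>If \<open>y\<close> already lies on \<open>p\<close>, the walk is cut off at
  \<open>y\<close> instead of being extended.\<close>

lemma distinct_walk_extend:
  assumes "is_walk G p" and "distinct p" and "{last p, y} \<in> edges G" and "y \<in> vertices G"
  shows "\<exists>q. is_walk G q \<and> distinct q \<and> hd q = hd p \<and> last q = y"
proof (cases "y \<in> set p")
  case True
  then obtain i where i: "i < length p" "p ! i = y" by (auto simp: in_set_conv_nth)
  have "last (take (Suc i) p) = y" using i by (simp add: take_Suc_conv_app_nth)
  moreover have "hd (take (Suc i) p) = hd p" by (simp add: hd_take)
  ultimately show ?thesis
    using is_walk_take[OF assms(1), of "Suc i"] assms(2) by (metis distinct_take zero_less_Suc)
next
  case False
  then show ?thesis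
    using is_walk_snoc[OF assms(1,3,4)] assms(1,2)
    by (intro exI[of _ "p @ [y]"]) (auto simp: is_walk_def)
qed

text \<open>The colouring "reachable from \<open>x\<close> by a distinct walk" is constant on edges,
  so linkedness gives \<open>y\<close> the colour of \<open>x\<close>. Distinctness is what later
  makes such a walk close up to a cycle.\<close>

lemma linked_imp_distinct_walk:
  assumes simple: "simple_graph G" and linked: "linked (vertices G) (edges G)"
    and x: "x \<in> vertices G" and y: "y \<in> vertices G"
  shows "\<exists>p. is_walk G p \<and> distinct p \<and> hd p = x \<and> last p = y"
proof -
  define c where "c z \<longleftrightarrow> (\<exists>p. is_walk G p \<and> distinct p \<and> hd p = x \<and> last p = z)" for z
  have step: "c b" if "e \<in> edges G" "a \<in> e" "b \<in> e" "c a" for e a b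
  proof (cases "a = b")
    case False
    have "card e = 2" "e \<subseteq> vertices G" using simple that by (auto simp: simple_graph_def)
    then have "e = {a, b}" using that False by (auto simp: card_2_iff)
    then show ?thesis
      using that \<open>e \<subseteq> vertices G\<close> distinct_walk_extend[of G _ b] unfolding c_def by fastforce
  qed (use that in simp)
  have "monochrome c (edges G)" unfolding monochrome_def using step by blast
  moreover have "c x" unfolding c_def by (rule exI[of _ "[x]"]) (use x in \<open>simp add: is_walk_def\<close>)
  ultimately have "c y" using linked x y unfolding linked_def by blast
  then show ?thesis by (simp add: c_def)
qed

lemma connected_graph_iff_linked:
  assumes "simple_graph G"
  shows "connected_graph G \<longleftrightarrow> vertices G \<noteq> {} \<and> linked (vertices G) (edges G)"
proof
  assume "connected_graph G"
  then show "vertices G \<noteq> {} \<and> linked (vertices G) (edges G)"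
    unfolding connected_graph_def linked_def using walk_monochrome by metis
next
  assume "vertices G \<noteq> {} \<and> linked (vertices G) (edges G)"
  then show "connected_graph G"
    unfolding connected_graph_def using linked_imp_distinct_walk[OF assms] by blast
qed

text \<open>The rest of the cycle still joins the ends of the closing edge, so a colouring that
  respects the other edges respects this one too.\<close>

lemma cycle_edge_redundant:
  assumes cycle: "is_cycle G p" and linked: "linked (vertices G) (edges G)"
  shows "linked (vertices G) (edges G - {{last p, hd p}})"
proof -
  let ?e = "{last p, hd p}"
  let ?H = "\<lparr>vertices = vertices G, edges = edges G - {?e}\<rparr>"
  have p: "is_walk G p" "distinct p" "length p \<ge> 3"
    using cycle by (auto simp: is_cycle_def)
  \<comment> \<open>The closing edge joins the first and last positions, which are not consecutive
    because \<open>p\<close> has at least three vertices.\<close>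
  have "{p ! i, p ! Suc i} \<noteq> ?e" if i: "Suc i < length p" for i
  proof -
    have "p \<noteq> []" using p by auto
    then have "last p = p ! (length p - 1)" "hd p = p ! 0"
      by (simp_all add: last_conv_nth hd_conv_nth)
    moreover have "0 < length p" "length p - 1 < length p" "i < length p" using p i by auto
    ultimately show ?thesis
      using p i by (auto simp: doubleton_eq_iff nth_eq_iff_index_eq)
  qed
  then have walk: "is_walk ?H p" using p by (auto simp: is_walk_def)
  have "monochrome c (edges G)" if c: "monochrome c (edges G - {?e})" for c
  proof -
    have "c (hd p) = c (last p)" using walk_monochrome[of c ?H p] walk c by simp
    then have "monochrome c (insert ?e (edges G - {?e}))" using c by (simp only: monochrome_edge)
    then show ?thesis by (rule monochrome_mono) auto
  qed
  then show ?thesis using linked by (simp add: linked_def)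
qed

text \<open>A distinct walk that avoids \<open>e\<close> but joins its ends is closed to a cycle by
  \<open>e\<close>.\<close>

lemma redundant_edge_cycle:
  assumes simple: "simple_graph G" and e: "e \<in> edges G"
    and linked: "linked (vertices G) (edges G - {e})"
  shows "\<exists>p. is_cycle G p"
proof -
  let ?H = "\<lparr>vertices = vertices G, edges = edges G - {e}\<rparr>"
  have "card e = 2" "e \<subseteq> vertices G" using simple e by (auto simp: simple_graph_def)
  then obtain a b where ab: "e = {a, b}" "a \<noteq> b" "a \<in> vertices G" "b \<in> vertices G"
    by (auto simp: card_2_iff)
  have "simple_graph ?H" using simple by (auto simp: simple_graph_def)
  then obtain p where p: "is_walk ?H p" "distinct p" "hd p = a" "last p = b"
    using linked_imp_distinct_walk[of ?H a b] linked ab by auto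
  have ne: "p \<noteq> []" using p by (simp add: is_walk_def)
  \<comment> \<open>Length one would identify the ends of \<open>e\<close>; length two would make
    the walk use \<open>e\<close> itself.\<close>
  have "length p \<noteq> 1"
    using p ab by (auto simp: length_Suc_conv)
  moreover have "length p \<noteq> 2"
  proof
    assume "length p = 2"
    then obtain x y where "p = [x, y]" by (auto simp: length_Suc_conv numeral_2_eq_2)
    then show False using p ab by (auto simp: is_walk_def)
  qed
  moreover have "length p \<noteq> 0" using ne by simp
  ultimately have "length p \<ge> 3" by linarith
  moreover have "is_walk G p" using p by (auto simp: is_walk_def)
  moreover have "{last p, hd p} \<in> edges G" using p e ab by (simp add: insert_commute)
  ultimately show ?thesis using p by (auto simp: is_cycle_def)
qed

lemma is_tree_iff_min_linked:
  assumes "simple_graph G" and "vertices G \<noteq> {}"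
  shows "is_tree G \<longleftrightarrow> min_linked (vertices G) (edges G)"
proof -
  have "{last p, hd p} \<in> edges G" if "is_cycle G p" for p
    using that by (simp add: is_cycle_def)
  then show ?thesis
    unfolding is_tree_def min_linked_def
    using assms connected_graph_iff_linked[OF assms(1)] cycle_edge_redundant[of G]
      redundant_edge_cycle[OF assms(1)]
    by blast
qed

lemma num_spanning_trees_eq:
  assumes simple: "simple_graph G" and ne: "vertices G \<noteq> {}"
  shows "num_spanning_trees G = card {F. F \<subseteq> edges G \<and> min_linked (vertices G) F}"
proof -
  let ?g = "\<lambda>F. \<lparr>vertices = vertices G, edges = F\<rparr>"
  have simple_sub: "simple_graph (?g F)" if "F \<subseteq> edges G" for F
    using simple that by (auto simp: simple_graph_def)
  have "is_spanning_tree H G \<longleftrightarrow> H \<in> ?g ` {F. F \<subseteq> edges G \<and> min_linked (vertices G) F}" for H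
  proof
    assume H: "is_spanning_tree H G"
    then have eq: "H = ?g (edges H)" by (simp add: is_spanning_tree_def)
    have "simple_graph H" "vertices H = vertices G" "edges H \<subseteq> edges G" "is_tree H"
      using H by (auto simp: is_spanning_tree_def sub_graph_def)
    then have "edges H \<in> {F. F \<subseteq> edges G \<and> min_linked (vertices G) F}"
      using is_tree_iff_min_linked[of H] ne by simp
    then show "H \<in> ?g ` {F. F \<subseteq> edges G \<and> min_linked (vertices G) F}"
      by (rule image_eqI[where f = ?g, OF eq])
  next
    assume "H \<in> ?g ` {F. F \<subseteq> edges G \<and> min_linked (vertices G) F}"
    then show "is_spanning_tree H G"
      using is_tree_iff_min_linked[OF simple_sub] simple_sub ne
      by (auto simp: is_spanning_tree_def sub_graph_def)
  qed
  then have "{H. is_spanning_tree H G} = ?g ` {F. F \<subseteq> edges G \<and> min_linked (vertices G) F}"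
    by blast
  moreover have "inj ?g" by (auto intro: injI)
  ultimately show ?thesis
    unfolding num_spanning_trees_def by (simp add: card_image inj_on_subset)
qed

section \<open>Joining two copies by two edges\<close>

definition bridge :: "bool list \<Rightarrow> bool list set" where
  "bridge x = {False # x, True # x}"

definition double :: "bool list set \<Rightarrow> bool list set" where
  "double V = Cons False ` V \<union> Cons True ` V"

text \<open>\<open>S\<close> lists the vertices whose two copies are joined. The argument is a
  triple so that a family of edge sets becomes the image of a set of triples, whose size is read off
  from products.\<close>

definition glue ::
    "bool list set set \<times> bool list set set \<times> bool list set \<Rightarrow> bool list set set" where
  "glue = (\<lambda>(F, F', S). image (Cons False) ` F \<union> image (Cons True) ` F' \<union> bridge ` S)"

lemma monochrome_glue:
  "monochrome d (glue (F, F', S)) \<longleftrightarrow> monochrome (\<lambda>x. d (False # x)) F \<and>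
    monochrome (\<lambda>x. d (True # x)) F' \<and> (\<forall>s\<in>S. d (False # s) = d (True # s))"
  by (auto simp: monochrome_def glue_def ball_Un bridge_def)

text \<open>A colouring of the double is a pair of colourings, one for each copy, and a bridge at
  \<open>s\<close> says that the pair agrees at \<open>s\<close>.\<close>

lemma linked_glue:
  "linked (double V) (glue (F, F', S)) \<longleftrightarrow>
    (\<forall>c c'. monochrome c F \<longrightarrow> monochrome c' F' \<longrightarrow> (\<forall>s\<in>S. c s = c' s) \<longrightarrow>
      (\<forall>x\<in>V. \<forall>y\<in>V. c x = c y \<and> c' x = c' y \<and> c x = c' y))" (is "?L \<longleftrightarrow> ?R")
proof
  assume L: ?L
  show ?R
  proof (intro allI impI)
    fix c c' :: "bool list \<Rightarrow> bool"
    let ?d = "\<lambda>z. if hd z then c' (tl z) else c (tl z)"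
    assume "monochrome c F" "monochrome c' F'" "\<forall>s\<in>S. c s = c' s"
    then have "monochrome ?d (glue (F, F', S))" by (simp add: monochrome_glue)
    then have K: "?d x = ?d y" if "x \<in> double V" "y \<in> double V" for x y
      using L that unfolding linked_def by blast
    show "\<forall>x\<in>V. \<forall>y\<in>V. c x = c y \<and> c' x = c' y \<and> c x = c' y"
    proof (intro ballI)
      fix x y assume "x \<in> V" "y \<in> V"
      then show "c x = c y \<and> c' x = c' y \<and> c x = c' y"
        using K[of "False # x" "False # y"] K[of "True # x" "True # y"] K[of "False # x" "True # y"]
        by (simp add: double_def)
    qed
  qed
next
  assume R: ?R
  show ?L
    unfolding linked_def
  proof (intro allI impI)
    fix d assume "monochrome d (glue (F, F', S))"
    then have K: "d (False # x) = d (False # y) \<and> d (True # x) = d (True # y) \<and>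
        d (False # x) = d (True # y)" if "x \<in> V" "y \<in> V" for x y
      using that R[rule_format, of "\<lambda>x. d (False # x)" "\<lambda>x. d (True # x)"]
      unfolding monochrome_glue by blast
    show "\<forall>x\<in>double V. \<forall>y\<in>double V. d x = d y"
    proof (intro ballI)
      fix x y assume "x \<in> double V" "y \<in> double V"
      then obtain a b x' y' where "x = a # x'" "y = b # y'" "x' \<in> V" "y' \<in> V"
        by (auto simp: double_def)
      then show "d x = d y" using K[of x' y'] K[of y' x'] by (cases a; cases b; metis)
    qed
  qed
qed

lemma linked_glueD:
  assumes "linked (double V) (glue (F, F', S))" and "monochrome c F" and "monochrome c' F'"
    and "\<forall>s\<in>S. c s = c' s" and "x \<in> V" and "y \<in> V"
  shows "c x = c y \<and> c' x = c' y \<and> c x = c' y"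
  using assms linked_glue[THEN iffD1] by blast

lemma linked_glue_none:
  assumes "x \<in> V"
  shows "\<not> linked (double V) (glue (F, F', {}))"
proof
  assume "linked (double V) (glue (F, F', {}))"
  then have "True = False"
    using assms linked_glueD[of V F F' "{}" "\<lambda>_. True" "\<lambda>_. False" x x]
    by (simp add: monochrome_const)
  then show False by simp
qed

text \<open>A colouring of one copy extends to the other by the constant colour \<open>c w\<close>,
  so each copy must be linked on its own. Conversely, the bridge carries the common colour
  across.\<close>

lemma linked_glue_one:
  assumes w: "w \<in> V"
  shows "linked (double V) (glue (F, F', {w})) \<longleftrightarrow> linked V F \<and> linked V F'"
proof
  assume L: "linked (double V) (glue (F, F', {w}))"
  note L' = linked_glueD[OF L]
  show "linked V F \<and> linked V F'"
    unfolding linked_def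
  proof (intro conjI allI impI ballI)
    fix c x y assume "monochrome c F" "x \<in> V" "y \<in> V"
    then show "c x = c y"
      by (intro L'[of c "\<lambda>_. c w" x y, THEN conjunct1]) (simp_all add: monochrome_const)
  next
    fix c x y assume "monochrome c F'" "x \<in> V" "y \<in> V"
    then show "c x = c y"
      by (intro L'[of "\<lambda>_. c w" c x y, THEN conjunct2, THEN conjunct1])
        (simp_all add: monochrome_const)
  qed
next
  assume "linked V F \<and> linked V F'"
  then have lk: "linked V F" "linked V F'" by auto
  show "linked (double V) (glue (F, F', {w}))"
    unfolding linked_glue
  proof (intro allI impI)
    fix c c' :: "bool list \<Rightarrow> bool"
    assume "monochrome c F" "monochrome c' F'" "\<forall>s\<in>{w}. c s = c' s"
    then have "\<forall>x\<in>V. c x = c w" "\<forall>x\<in>V. c' x = c w"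
      using lk w unfolding linked_def by blast+
    then show "\<forall>x\<in>V. \<forall>y\<in>V. c x = c y \<and> c' x = c' y \<and> c x = c' y" by simp
  qed
qed

text \<open>Each copy may use the other as a detour from \<open>u\<close> to \<open>v\<close>, which
  acts like an added edge. Both cannot rely on this: two colourings that split \<open>u\<close> from
  \<open>v\<close> would fit together across the bridges.\<close>

lemma linked_glue_two:
  assumes u: "u \<in> V" and v: "v \<in> V"
  shows "linked (double V) (glue (F, F', {u, v})) \<longleftrightarrow>
    linked V F \<and> linked V (insert {u, v} F') \<or> linked V (insert {u, v} F) \<and> linked V F'"
    (is "?L \<longleftrightarrow> ?R")
proof
  assume L: ?L
  note L' = linked_glueD[OF L]
  \<comment> \<open>A colouring with \<open>c u = c v\<close> extends to the other copy by the
    constant colour \<open>c u\<close>, which agrees with it at both bridges.\<close>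
  have D: "linked V (insert {u, v} F) \<and> linked V (insert {u, v} F')"
    unfolding linked_def monochrome_edge
  proof (intro conjI allI impI ballI; elim conjE)
    fix c x y assume "monochrome c F" "c u = c v" "x \<in> V" "y \<in> V"
    then show "c x = c y"
      by (intro L'[of c "\<lambda>_. c u" x y, THEN conjunct1]) (simp_all add: monochrome_const)
  next
    fix c x y assume "monochrome c F'" "c u = c v" "x \<in> V" "y \<in> V"
    then show "c x = c y"
      by (intro L'[of "\<lambda>_. c u" c x y, THEN conjunct2, THEN conjunct1])
        (simp_all add: monochrome_const)
  qed
  have "linked V F \<or> linked V F'"
  proof (rule ccontr)
    assume "\<not> (linked V F \<or> linked V F')"
    then obtain c c' where c: "monochrome c F" "\<not> (\<forall>x\<in>V. \<forall>y\<in>V. c x = c y)"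
      and c': "monochrome c' F'" "\<not> (\<forall>x\<in>V. \<forall>y\<in>V. c' x = c' y)"
      unfolding linked_def by blast
    \<comment> \<open>By \<open>D\<close>, a non-constant colouring of either copy must separate
      \<open>u\<close> from \<open>v\<close>.\<close>
    have "\<not> monochrome c (insert {u, v} F)" "\<not> monochrome c' (insert {u, v} F')"
      using D c(2) c'(2) unfolding linked_def by blast+
    then have ne: "c u \<noteq> c v" "c' u \<noteq> c' v"
      using c(1) c'(1) by (simp_all add: monochrome_edge)
    \<comment> \<open>There are only two colours, so after swapping them if necessary the two colourings
      agree on both ends.\<close>
    show False
    proof (cases "c u = c' u")
      case True
      then have "\<forall>s\<in>{u, v}. c s = c' s" using ne by blast
      from L'[OF c(1) c'(1) this u v] show False using ne by blast
    next
      case False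
      have "monochrome (\<lambda>x. \<not> c' x) F'" using c'(1) by (simp add: monochrome_neg)
      moreover have "\<forall>s\<in>{u, v}. c s = (\<not> c' s)" using False ne by blast
      ultimately show False using L'[OF c(1) _ _ u v] ne by blast
    qed
  qed
  then show ?R using D by blast
next
  assume ?R
  show ?L
    unfolding linked_glue
  proof (intro allI impI)
    fix c c' :: "bool list \<Rightarrow> bool"
    assume c: "monochrome c F" "monochrome c' F'" and "\<forall>s\<in>{u, v}. c s = c' s"
    then have eq: "c u = c' u" "c v = c' v" by auto
    \<comment> \<open>The linked copy gives both ends one colour; the bridges pass this on, so the
      colouring of the other copy respects the added edge.\<close>
    from \<open>?R\<close> have "(\<forall>x\<in>V. c x = c u) \<and> (\<forall>x\<in>V. c' x = c' u)"
    proof (elim disjE conjE)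
      assume lk: "linked V F" "linked V (insert {u, v} F')"
      have "\<forall>x\<in>V. c x = c u" using lk(1) c(1) u unfolding linked_def by blast
      then have "monochrome c' (insert {u, v} F')" using c eq v by (simp add: monochrome_edge)
      then show ?thesis using lk(2) u \<open>\<forall>x\<in>V. c x = c u\<close> unfolding linked_def by blast
    next
      assume lk: "linked V (insert {u, v} F)" "linked V F'"
      have "\<forall>x\<in>V. c' x = c' u" using lk(2) c(2) u unfolding linked_def by blast
      then have "monochrome c (insert {u, v} F)" using c eq v by (simp add: monochrome_edge)
      then show ?thesis using lk(1) u \<open>\<forall>x\<in>V. c' x = c' u\<close> unfolding linked_def by blast
    qed
    then show "\<forall>x\<in>V. \<forall>y\<in>V. c x = c y \<and> c' x = c' y \<and> c x = c' y" using eq by simp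
  qed
qed

section \<open>Telling the edges of a glued set apart\<close>

lemma bridge_eq_iff [simp]: "bridge x = bridge y \<longleftrightarrow> x = y"
  by (auto simp: bridge_def doubleton_eq_iff)

lemma bridge_neq_copy [simp]: "bridge x \<noteq> Cons b ` e" "Cons b ` e \<noteq> bridge x"
proof -
  have "(\<not> b) # x \<in> bridge x" by (cases b) (auto simp: bridge_def)
  moreover have "(\<not> b) # x \<notin> Cons b ` e" by auto
  ultimately show "bridge x \<noteq> Cons b ` e" "Cons b ` e \<noteq> bridge x" by metis+
qed

lemma inj_image_Cons [simp]: "Cons b ` e = Cons b ` e' \<longleftrightarrow> e = e'"
  by (simp add: inj_image_eq_iff)

text \<open>The empty set has the same image in both copies; this is the source of the assumptions
  \<open>{} \<notin> F\<close> below.\<close>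

lemma copies_disjoint:
  assumes "e \<noteq> {}"
  shows "Cons False ` e \<noteq> Cons True ` e'" "Cons True ` e \<noteq> Cons False ` e'"
  using assms by auto

lemma glue_left: "Cons False ` e \<in> glue (F, F', S) \<longleftrightarrow> e \<in> F" if "e \<noteq> {}"
  using copies_disjoint[OF that] by (auto simp: glue_def)

lemma glue_right: "Cons True ` e \<in> glue (F, F', S) \<longleftrightarrow> e \<in> F'" if "e \<noteq> {}"
  using copies_disjoint[OF that] by (auto simp: glue_def)

lemma glue_bridge: "bridge s \<in> glue (F, F', S) \<longleftrightarrow> s \<in> S"
  by (auto simp: glue_def)

text \<open>Bridges and copies of nonempty edges never coincide, so deleting one edge changes one
  component of the triple. Minimality can thus be tested component by component.\<close>

lemma glue_diff:
  shows "{} \<notin> F \<Longrightarrow> e \<in> F \<Longrightarrow> glue (F, F', S) - {Cons False ` e} = glue (F - {e}, F', S)"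
    and "{} \<notin> F' \<Longrightarrow> e \<in> F' \<Longrightarrow> glue (F, F', S) - {Cons True ` e} = glue (F, F' - {e}, S)"
    and "glue (F, F', S) - {bridge s} = glue (F, F', S - {s})"
proof -
  have inj: "inj (image (Cons b))" "inj bridge" for b :: bool
    by (auto intro: injI)
  have Diff: "z \<notin> Q \<union> R \<Longrightarrow> P \<union> Q \<union> R - {z} = (P - {z}) \<union> Q \<union> R"
    "z \<notin> P \<union> R \<Longrightarrow> P \<union> Q \<union> R - {z} = P \<union> (Q - {z}) \<union> R"
    "z \<notin> P \<union> Q \<Longrightarrow> P \<union> Q \<union> R - {z} = P \<union> Q \<union> (R - {z})"
    for P Q R and z :: "bool list set"
    by blast+
  note diff = image_set_diff[OF inj(1)] image_set_diff[OF inj(2)]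
  show "glue (F, F', S) - {Cons False ` e} = glue (F - {e}, F', S)" if "{} \<notin> F" "e \<in> F"
  proof -
    have "e \<noteq> {}" using that by blast
    then have "Cons False ` e \<notin> image (Cons True) ` F' \<union> bridge ` S"
      using copies_disjoint(1) by auto
    then show ?thesis unfolding glue_def prod.case diff image_insert image_empty by (rule Diff(1))
  qed
  show "glue (F, F', S) - {Cons True ` e} = glue (F, F' - {e}, S)" if "{} \<notin> F'" "e \<in> F'"
  proof -
    have "e \<noteq> {}" using that by blast
    then have "Cons True ` e \<notin> image (Cons False) ` F \<union> bridge ` S"
      using copies_disjoint(2) by auto
    then show ?thesis unfolding glue_def prod.case diff image_insert image_empty by (rule Diff(2))
  qed
  have "bridge s \<notin> image (Cons False) ` F \<union> image (Cons True) ` F'" by auto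
  then show "glue (F, F', S) - {bridge s} = glue (F, F', S - {s})"
    unfolding glue_def prod.case diff image_insert image_empty by (rule Diff(3))
qed

lemma ball_glue: "(\<forall>e\<in>glue (F, F', S). P e) \<longleftrightarrow>
    (\<forall>e\<in>F. P (Cons False ` e)) \<and> (\<forall>e\<in>F'. P (Cons True ` e)) \<and> (\<forall>s\<in>S. P (bridge s))"
  by (auto simp: glue_def)

section \<open>Minimal linked sets in the double\<close>

lemma min_linked_glue:
  assumes "{} \<notin> F" "{} \<notin> F'"
  shows "min_linked V (glue (F, F', S)) \<longleftrightarrow> linked V (glue (F, F', S)) \<and>
    (\<forall>e\<in>F. \<not> linked V (glue (F - {e}, F', S))) \<and>
    (\<forall>e\<in>F'. \<not> linked V (glue (F, F' - {e}, S))) \<and>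
    (\<forall>s\<in>S. \<not> linked V (glue (F, F', S - {s})))"
  unfolding min_linked_def ball_glue by (simp add: glue_diff assms)

text \<open>These are the spanning forests with two components that separate \<open>u\<close> from \<open>v\<close>: adding the
  edge between \<open>u\<close> and \<open>v\<close> makes them trees.\<close>

definition cut_forest :: "'a set \<Rightarrow> 'a \<Rightarrow> 'a \<Rightarrow> 'a set set \<Rightarrow> bool" where
  "cut_forest V u v F \<longleftrightarrow> {u, v} \<notin> F \<and> min_linked V (insert {u, v} F)"

text \<open>\<open>\<not> linked V F\<close> is minimality at the added edge. It also encodes
  \<open>{u, v} \<notin> F\<close>: otherwise inserting the edge changes nothing and the first two
  conjuncts clash.\<close>

lemma cut_forest_iff:
  "cut_forest V u v F \<longleftrightarrow> linked V (insert {u, v} F) \<and> \<not> linked V F \<and>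
    (\<forall>e\<in>F. \<not> linked V (insert {u, v} (F - {e})))"
proof (cases "{u, v} \<in> F")
  case True
  then show ?thesis by (auto simp: cut_forest_def insert_absorb)
next
  case False
  then have "insert {u, v} F - {e} = insert {u, v} (F - {e})" if "e \<in> F" for e
    using that by auto
  then show ?thesis using False by (auto simp: cut_forest_def min_linked_def)
qed

lemma min_linked_glue_none:
  assumes "u \<in> V"
  shows "\<not> min_linked (double V) (glue (F, F', {}))"
  using linked_glue_none[OF assms] by (simp add: min_linked_def)

lemma min_linked_glue_one:
  assumes "{} \<notin> F" "{} \<notin> F'" and "w \<in> V"
  shows "min_linked (double V) (glue (F, F', {w})) \<longleftrightarrow> min_linked V F \<and> min_linked V F'"
  unfolding min_linked_glue[OF assms(1,2)]
  using linked_glue_none[OF assms(3)] by (auto simp: linked_glue_one[OF assms(3)] min_linked_def)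

text \<open>If both copies were linked, one bridge could be dropped. So exactly one is linked, and
  the other becomes linked only through the added edge.\<close>

lemma min_linked_glue_two:
  assumes ne: "{} \<notin> F" "{} \<notin> F'" and uv: "u \<in> V" "v \<in> V" "u \<noteq> v"
  shows "min_linked (double V) (glue (F, F', {u, v})) \<longleftrightarrow>
    min_linked V F \<and> cut_forest V u v F' \<or> cut_forest V u v F \<and> min_linked V F'"
proof -
  have "{u, v} - {u} = {v}" "{u, v} - {v} = {u}" using uv by auto
  moreover have insertI: "linked V H \<Longrightarrow> linked V (insert {u, v} H)" for H
    by (erule linked_mono) auto
  moreover have DiffI: "\<not> linked V H \<Longrightarrow> \<not> linked V (H - {e})" for H e
    using linked_mono[of V "H - {e}" H] by auto
  ultimately show ?thesis
    unfolding min_linked_glue[OF ne] cut_forest_iff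
    \<comment> \<open>Both sides fail when both copies are linked or neither is; the content lies in
      the two mixed cases.\<close>
    by (cases "linked V F"; cases "linked V F'")
      (auto simp: linked_glue_one linked_glue_two uv min_linked_def insertI DiffI)
qed

section \<open>Counting\<close>

definition trees :: "'a set \<Rightarrow> 'a set set \<Rightarrow> 'a set set set" where
  "trees V E = {F. F \<subseteq> E \<and> min_linked V F}"

definition cuts :: "'a set \<Rightarrow> 'a \<Rightarrow> 'a \<Rightarrow> 'a set set \<Rightarrow> 'a set set set" where
  "cuts V u v E = {F. F \<subseteq> E \<and> cut_forest V u v F}"

lemma finite_trees: "finite E \<Longrightarrow> finite (trees V E)"
  by (rule finite_subset[of _ "Pow E"]) (auto simp: trees_def)

lemma finite_cuts: "finite E \<Longrightarrow> finite (cuts V u v E)"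
  by (rule finite_subset[of _ "Pow E"]) (auto simp: cuts_def)

lemma trees_cuts_disjoint: "trees V E \<inter> cuts V u v E = {}"
  by (auto simp: trees_def cuts_def cut_forest_iff min_linked_def)

text \<open>Adding and removing the marked edge are inverse to each other. This reduces counting cut
  forests of the double to counting its trees through one given bridge.\<close>

lemma card_cuts:
  assumes "{u, v} \<in> E"
  shows "card (cuts V u v E) = card {F \<in> trees V E. {u, v} \<in> F}"
proof (rule bij_betw_same_card)
  show "bij_betw (insert {u, v}) (cuts V u v E) {F \<in> trees V E. {u, v} \<in> F}"
    by (rule bij_betw_byWitness[where f' = "\<lambda>F. F - {{u, v}}"])
      (use assms in \<open>auto simp: cuts_def trees_def cut_forest_def insert_absorb\<close>)
qed

lemma subset_glueE:
  assumes "H \<subseteq> glue (E, E', W)"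
  obtains F F' S where "F \<subseteq> E" "F' \<subseteq> E'" "S \<subseteq> W" "H = glue (F, F', S)"
proof
  let ?F = "{e \<in> E. Cons False ` e \<in> H}" and ?F' = "{e \<in> E'. Cons True ` e \<in> H}"
  let ?S = "{s \<in> W. bridge s \<in> H}"
  show "H = glue (?F, ?F', ?S)"
  proof (rule subset_antisym)
    show "H \<subseteq> glue (?F, ?F', ?S)"
    proof
      fix h assume "h \<in> H"
      then show "h \<in> glue (?F, ?F', ?S)" using assms by (auto simp: glue_def)
    qed
  qed (auto simp: glue_def)
qed auto

lemma glue_subset:
  "F \<subseteq> E \<Longrightarrow> F' \<subseteq> E' \<Longrightarrow> S \<subseteq> W \<Longrightarrow> glue (F, F', S) \<subseteq> glue (E, E', W)"
  by (auto simp: glue_def)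

text \<open>\<open>Pow (- {{}})\<close> consists of the families without the empty set; for them,
  membership of copied edges and bridges recovers all three components.\<close>

lemma inj_on_glue: "inj_on glue (Pow (- {{}}) \<times> Pow (- {{}}) \<times> UNIV)"
proof (rule inj_onI)
  fix p p' :: "bool list set set \<times> bool list set set \<times> bool list set"
  obtain F F' S H H' T where p: "p = (F, F', S)" "p' = (H, H', T)"
    by (metis prod.exhaust)
  assume "p \<in> Pow (- {{}}) \<times> Pow (- {{}}) \<times> UNIV" "p' \<in> Pow (- {{}}) \<times> Pow (- {{}}) \<times> UNIV"
    and "glue p = glue p'"
  then have ne: "{} \<notin> F" "{} \<notin> F'" "{} \<notin> H" "{} \<notin> H'"
    and eq: "glue (F, F', S) = glue (H, H', T)"
    unfolding p by auto
  have "F = H"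
  proof (rule set_eqI)
    fix e
    show "e \<in> F \<longleftrightarrow> e \<in> H"
      using glue_left[of e F F' S] glue_left[of e H H' T] eq ne by (cases "e = {}") auto
  qed
  moreover have "F' = H'"
  proof (rule set_eqI)
    fix e
    show "e \<in> F' \<longleftrightarrow> e \<in> H'"
      using glue_right[of e F F' S] glue_right[of e H H' T] eq ne by (cases "e = {}") auto
  qed
  moreover have "S = T"
    using glue_bridge[of _ F F' S] glue_bridge[of _ H H' T] eq by (simp add: set_eq_iff)
  ultimately show "p = p'" by (simp add: p)
qed

locale marked_graph =
  fixes V :: "bool list set" and E :: "bool list set set" and u v :: "bool list"
  assumes finite_edges: "finite E" and edges_nonempty: "{} \<notin> E"
    and ends: "u \<in> V" "v \<in> V" "u \<noteq> v"
begin

abbreviation "A \<equiv> trees V E"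
abbreviation "B \<equiv> cuts V u v E"
abbreviation "E2 \<equiv> glue (E, E, {u, v})"

lemma subset_nonempty: "F \<subseteq> E \<Longrightarrow> {} \<notin> F"
  using edges_nonempty by blast

lemma trees_double:
  "trees (double V) E2 =
    glue ` (A \<times> A \<times> {{u}, {v}} \<union> A \<times> B \<times> {{u, v}} \<union> B \<times> A \<times> {{u, v}})" (is "_ = glue ` ?P")
proof -
  have iff: "min_linked (double V) (glue (F, F', S)) \<longleftrightarrow> (F, F', S) \<in> ?P"
    if sub: "F \<subseteq> E" "F' \<subseteq> E" "S \<subseteq> {u, v}" for F F' S
  proof -
    have ne: "{} \<notin> F" "{} \<notin> F'" using sub subset_nonempty by auto
    have "S = {} \<or> S = {u} \<or> S = {v} \<or> S = {u, v}" using sub(3) by blast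
    then show ?thesis
      using sub ends min_linked_glue_none[OF ends(1)] min_linked_glue_one[OF ne]
        min_linked_glue_two[OF ne ends]
      by (elim disjE) (auto simp: trees_def cuts_def doubleton_eq_iff)
  qed
  have sub: "F \<subseteq> E \<and> F' \<subseteq> E \<and> S \<subseteq> {u, v}" if "(F, F', S) \<in> ?P" for F F' S
    using that by (auto simp: trees_def cuts_def)
  show ?thesis
  proof (intro set_eqI iffI)
    fix H assume "H \<in> trees (double V) E2"
    then have "H \<subseteq> E2" "min_linked (double V) H" by (auto simp: trees_def)
    then obtain F F' S where "F \<subseteq> E" "F' \<subseteq> E" "S \<subseteq> {u, v}" "H = glue (F, F', S)"
      by (elim subset_glueE)
    then show "H \<in> glue ` ?P" using iff \<open>min_linked (double V) H\<close> by blast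
  next
    fix H assume "H \<in> glue ` ?P"
    then obtain F F' S where P: "(F, F', S) \<in> ?P" and H: "H = glue (F, F', S)" by auto
    then show "H \<in> trees (double V) E2"
      using iff sub[OF P] glue_subset[of F E F' E S "{u, v}"] by (auto simp: trees_def)
  qed
qed

text \<open>\<open>W\<close> is the set of admissible single-bridge choices: both bridges when all
  trees are counted, only the one at \<open>u\<close> when that bridge is prescribed.\<close>

lemma card_glue:
  assumes "finite W" and "{u, v} \<notin> W"
  shows "card (glue ` (A \<times> A \<times> W \<union> A \<times> B \<times> {{u, v}} \<union> B \<times> A \<times> {{u, v}})) =
    card W * card A ^ 2 + 2 * card A * card B"
proof -
  let ?P = "A \<times> A \<times> W \<union> A \<times> B \<times> {{u, v}} \<union> B \<times> A \<times> {{u, v}}"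
  have "?P \<subseteq> Pow (- {{}}) \<times> Pow (- {{}}) \<times> UNIV"
    using edges_nonempty by (auto simp: trees_def cuts_def)
  then have "inj_on glue ?P" using inj_on_glue inj_on_subset by blast
  moreover have "finite A" "finite B"
    using finite_trees[OF finite_edges] finite_cuts[OF finite_edges] by auto
  moreover have "(A \<times> A \<times> W \<union> A \<times> B \<times> {{u, v}}) \<inter> B \<times> A \<times> {{u, v}} = {}"
    using trees_cuts_disjoint[of V E u v] by blast
  moreover have "A \<times> A \<times> W \<inter> A \<times> B \<times> {{u, v}} = {}"
    using assms(2) by blast
  ultimately show ?thesis
    using assms(1) by (simp add: card_image card_Un_disjoint power2_eq_square)
qed

lemma card_trees_double: "card (trees (double V) E2) = 2 * card A ^ 2 + 2 * card A * card B"
proof -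
  have "{u, v} \<notin> {{u}, {v}}" "card {{u}, {v}} = 2" using ends by auto
  then show ?thesis unfolding trees_double using card_glue[of "{{u}, {v}}"] by simp
qed

text \<open>The marked edge of the double is the bridge at \<open>u\<close>. Every two-bridge tree
  contains it, but only one of the two single-bridge families does.\<close>

lemma card_cuts_double:
  "card (cuts (double V) (False # u) (True # u) E2) = card A ^ 2 + 2 * card A * card B"
proof -
  have "{F \<in> trees (double V) E2. bridge u \<in> F} =
      glue ` (A \<times> A \<times> {{u}} \<union> A \<times> B \<times> {{u, v}} \<union> B \<times> A \<times> {{u, v}})"
    unfolding trees_double using ends(3) by (auto simp: glue_bridge)
  moreover have "{u, v} \<notin> {{u}}" using ends by auto
  moreover have "bridge u \<in> E2" by (simp add: glue_bridge)
  ultimately show ?thesis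
    using card_cuts[of "False # u" "True # u" E2 "double V"] card_glue[of "{{u}}"]
    by (simp add: bridge_def)
qed

end

section \<open>The recursion for the graphs M(t)\<close>

definition M_trees :: "nat \<Rightarrow> nat" where
  "M_trees t = card (trees (vertices (M_graph t)) (edges (M_graph t)))"

definition M_cuts :: "nat \<Rightarrow> nat" where
  "M_cuts t = card (cuts (vertices (M_graph t)) (M_u t) (M_v t) (edges (M_graph t)))"

lemma M_graph_Suc:
  "vertices (M_graph (Suc t)) = double (vertices (M_graph t))"
  "edges (M_graph (Suc t)) = glue (edges (M_graph t), edges (M_graph t), {M_u t, M_v t})"
  by (simp_all add: double_def glue_def bridge_def)

lemma M_marked_graph: "marked_graph (vertices (M_graph t)) (edges (M_graph t)) (M_u t) (M_v t)"
proof
  have simple: "simple_graph (M_graph t)" "finite (vertices (M_graph t))"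
    using finite_simple_graph_M[of t] by (auto simp: finite_simple_graph_def)
  then have "edges (M_graph t) \<subseteq> Pow (vertices (M_graph t))"
    by (auto simp: simple_graph_def)
  then show "finite (edges (M_graph t))" using simple(2) by (meson finite_Pow_iff finite_subset)
  show "{} \<notin> edges (M_graph t)" using simple(1) by (auto simp: simple_graph_def)
  show "M_u t \<in> vertices (M_graph t)" "M_v t \<in> vertices (M_graph t)"
    using simple(1) M_distinguished_edge[of t] by (auto simp: simple_graph_def)
  show "M_u t \<noteq> M_v t" by (cases t) auto
qed

lemma M_trees_Suc: "M_trees (Suc t) = 2 * M_trees t ^ 2 + 2 * M_trees t * M_cuts t"
  using marked_graph.card_trees_double[OF M_marked_graph, of t]
  unfolding M_trees_def M_cuts_def M_graph_Suc .

lemma M_cuts_Suc: "M_cuts (Suc t) = M_trees t ^ 2 + 2 * M_trees t * M_cuts t"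
  using marked_graph.card_cuts_double[OF M_marked_graph, of t]
  unfolding M_trees_def M_cuts_def M_graph_Suc M_u.simps M_v.simps .

lemma M_0: "M_trees 0 = 1" "M_cuts 0 = 1"
proof -
  let ?x = "[False]" and ?y = "[True]"
  have full: "linked {?x, ?y} {{?x, ?y}}" by (simp add: linked_def monochrome_edge)
  have "monochrome (\<lambda>z. z = ?x) {}" by (simp add: monochrome_def)
  then have empty: "\<not> linked {?x, ?y} {}" unfolding linked_def by auto
  have "trees {?x, ?y} {{?x, ?y}} = {{{?x, ?y}}}"
    using full empty by (auto simp: trees_def min_linked_def subset_singleton_iff)
  then show "M_trees 0 = 1" by (simp add: M_trees_def)
  have "cuts {?x, ?y} ?x ?y {{?x, ?y}} = {{}}"
    using full empty by (auto simp: cuts_def cut_forest_iff subset_singleton_iff)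
  then show "M_cuts 0 = 1" by (simp add: M_cuts_def)
qed

lemma num_spanning_trees_M: "num_spanning_trees (M_graph t) = M_trees t"
proof -
  have "simple_graph (M_graph t)" "vertices (M_graph t) \<noteq> {}"
    using finite_simple_graph_M[of t] marked_graph.ends(1)[OF M_marked_graph, of t]
    by (auto simp: finite_simple_graph_def)
  then show ?thesis by (simp add: num_spanning_trees_eq M_trees_def trees_def)
qed

section \<open>Solving the recursion\<close>

text \<open>\<open>3 - 2 * sqrt 2\<close> is the derivative of the Moebius map for \<open>r\<close>
  at its fixed point \<open>sqrt 2 / 2\<close>; the factors tend to \<open>2 + sqrt 2\<close>, which
  is \<open>2 * (1 + r)\<close> there.\<close>

definition M_factor :: "nat \<Rightarrow> real" where
  "M_factor i = 2 - sqrt 2 + 2 * sqrt 2 / (1 - (3 - 2 * sqrt 2) ^ i)"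

text \<open>For \<open>m = 2 * (1 + r)\<close> the recursion of the ratio becomes
  \<open>m' = 4 - 2 / m\<close>, here cleared of fractions. Indices start at \<open>Suc t\<close>
  because the denominator in \<open>M_factor 0\<close> is zero.\<close>

lemma M_factor_Suc: "M_factor (Suc t) * M_factor (Suc (Suc t)) = 4 * M_factor (Suc t) - 2"
proof -
  define s :: real where "s = sqrt 2"
  define q where "q = 3 - 2 * s"
  define x where "x = q ^ Suc t"
  have s2: "s * s = 2" by (simp add: s_def)
  \<comment> \<open>The bounds on \<open>s\<close> place \<open>q\<close> strictly between 0 and 1,
    so neither denominator vanishes.\<close>
  have "s > 1" by (simp add: s_def)
  moreover have "s < 3 / 2"
    unfolding s_def by (rule real_less_lsqrt) (simp_all add: power2_eq_square)
  ultimately have q: "0 < q" "q < 1" by (auto simp: q_def)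
  then have x: "x < 1" "q * x < 1"
    using power_Suc_less_one[of q t] power_Suc_less_one[of q "Suc t"] by (simp_all add: x_def)
  let ?y = "1 - x" and ?z = "1 - q * x"
  let ?P = "(2 - s) * ?y + 2 * s" and ?Q = "(2 - s) * ?z + 2 * s"
  have yz: "?y \<noteq> 0" "?z \<noteq> 0" using x by auto
  \<comment> \<open>A polynomial identity in \<open>s\<close> and \<open>x\<close>; the factor
    \<open>s * s - 2\<close> makes the difference vanish.\<close>
  have "?P * ?Q - (4 * ?P - 2 * ?y) * ?z = (s * s - 2) * (1 - (2 * s + 4) * x + q * (x * x))"
    unfolding q_def by algebra
  then have "?P * ?Q = (4 * ?P - 2 * ?y) * ?z" using s2 by simp
  then have "(?P / ?y) * (?Q / ?z) = 4 * (?P / ?y) - 2" using yz by (simp add: divide_simps)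
  moreover have "?P / ?y = 2 - s + 2 * s / ?y" "?Q / ?z = 2 - s + 2 * s / ?z"
    using yz by (simp_all add: add_divide_distrib)
  ultimately have "(2 - s + 2 * s / ?y) * (2 - s + 2 * s / ?z) = 4 * (2 - s + 2 * s / ?y) - 2"
    by simp
  then show ?thesis by (simp add: M_factor_def x_def q_def s_def)
qed

text \<open>In terms of the ratio \<open>r\<close> of the two counts this says \<open>M_factor (t + 1) = 2 (1 + r)\<close>.\<close>

lemma M_cuts_closed_form:
  "2 * (real (M_trees t) + real (M_cuts t)) = real (M_trees t) * M_factor (Suc t)"
proof (induction t)
  case 0
  \<comment> \<open>Both counts start at 1, so the claim is \<open>M_factor 1 = 4\<close>; this
    evaluates its fraction as \<open>sqrt 2 + 2\<close>.\<close>
  have "(1 - (3 - 2 * sqrt 2)) * (sqrt 2 + 2) = 2 * sqrt 2" by (simp add: algebra_simps)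
  moreover have "1 - (3 - 2 * sqrt 2) \<noteq> (0::real)" by (auto simp: real_sqrt_eq_1_iff)
  ultimately have "2 * sqrt 2 / (1 - (3 - 2 * sqrt 2)) = sqrt 2 + 2"
    by (metis nonzero_mult_div_cancel_left)
  then show ?case by (simp add: M_0 M_factor_def)
next
  case (Suc t)
  let ?a = "real (M_trees t)" and ?b = "real (M_cuts t)"
  \<comment> \<open>The terms are grouped so that \<open>?b\<close> occurs only in
    \<open>2 * (?a + ?b)\<close>, where the induction hypothesis applies.\<close>
  have "2 * (real (M_trees (Suc t)) + real (M_cuts (Suc t))) = ?a * (4 * (2 * (?a + ?b)) - 2 * ?a)"
    by (simp add: M_trees_Suc M_cuts_Suc algebra_simps power2_eq_square)
  also have "\<dots> = ?a * (?a * (4 * M_factor (Suc t) - 2))"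
    unfolding Suc by (simp add: algebra_simps)
  also have "\<dots> = ?a * (?a * M_factor (Suc t)) * M_factor (Suc (Suc t))"
    unfolding M_factor_Suc[symmetric] by (simp only: mult.assoc)
  also have "?a * (?a * M_factor (Suc t)) = real (M_trees (Suc t))"
    unfolding Suc[symmetric] by (simp add: M_trees_Suc algebra_simps power2_eq_square)
  finally show ?case .
qed

text \<open>Since \<open>a' = 2 * a * (a + b)\<close>, each step squares the count and contributes
  one new factor; squaring doubles the exponents of the earlier factors.\<close>

lemma M_trees_closed_form: "real (M_trees t) = (\<Prod>i=1..t. M_factor i ^ (2 ^ (t - i)))"
proof (induction t)
  case 0
  show ?case by (simp add: M_0)
next
  case (Suc t)
  have "real (M_trees (Suc t)) = real (M_trees t) * (2 * (real (M_trees t) + real (M_cuts t)))"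
    by (simp add: M_trees_Suc algebra_simps power2_eq_square)
  also have "\<dots> = real (M_trees t) ^ 2 * M_factor (Suc t)"
    by (simp only: M_cuts_closed_form power2_eq_square mult.assoc)
  also have "real (M_trees t) ^ 2 = (\<Prod>i=1..t. M_factor i ^ (2 ^ (Suc t - i)))"
    unfolding Suc prod_power_distrib
    by (intro prod.cong refl) (simp add: Suc_diff_le power_mult[symmetric] mult.commute)
  finally show ?case by simp
qed

theorem theorem1:
  fixes t :: nat
  assumes "t \<ge> 1"
  shows "real (num_spanning_trees (M_graph t)) =
    (\<Prod>i=1..t. (2 - sqrt 2 + 2 * sqrt 2 / (1 - (3 - 2 * sqrt 2) ^ i)) ^ (2 ^ (t - i)))"
  using M_trees_closed_form[of t] by (simp only: num_spanning_trees_M M_factor_def)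

end
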